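(* For every integer $n \geq 3$ we have $$\overline{d}(2,n) \geq (n/5)^{5/4}.$$
   Context: A planar integral point set is a set $M$ of points in the Euclidean plane such that all Euclidean distances between points of $M$ are integers and $M$ is not contained in a straight line (every such set is finite). $\mathfrak{M}(2,n)$ denotes the set of all planar integral point sets consisting of exactly $n$ points. A set $M\in\mathfrak{M}(2,n)$ is in semi-general position if no three points of $M$ are collinear; $\overline{\mathfrak{M}}(2,n)$ denotes the set of all $M\in\mathfrak{M}(2,n)$ in semi-general position. The diameter of $M$ is $\operatorname{diam} M = \max_{A,B\in M}|AB|$, where $|AB|$ is the Euclidean distance. Finally, $\overline{d}(2,n) = \min_{M\in\overline{\mathfrak{M}}(2,n)} \operatorname{diam} M$. *)

theory Defs
  imports "HOL-Analysis.Analysis"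
begin

definition planar_integral_point_set :: "(real ^ 2) set \<Rightarrow> bool" where
  "planar_integral_point_set M \<longleftrightarrow>
     (\<forall>A\<in>M. \<forall>B\<in>M. dist A B \<in> \<int>) \<and> \<not> collinear M"

text \<open>The conjunct \<open>finite M\<close> only excludes the convention that infinite sets have
  cardinality 0.\<close>

definition integral_point_sets :: "nat \<Rightarrow> (real ^ 2) set set" where
  "integral_point_sets n = {M. planar_integral_point_set M \<and> finite M \<and> card M = n}"

definition semi_general_position :: "(real ^ 2) set \<Rightarrow> bool" where
  "semi_general_position M \<longleftrightarrow>
     (\<forall>A\<in>M. \<forall>B\<in>M. \<forall>C\<in>M. A \<noteq> B \<and> A \<noteq> C \<and> B \<noteq> C \<longrightarrow> \<not> collinear {A, B, C})"

definition semi_general_integral_point_sets :: "nat \<Rightarrow> (real ^ 2) set set" where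
  "semi_general_integral_point_sets n =
     {M \<in> integral_point_sets n. semi_general_position M}"

text \<open>The minimum is rendered by \<open>LEAST\<close>, which is a specified value only if the minimum
  is attained; any bound on it thus presupposes that such point sets exist. The library's
  \<open>diameter\<close> is a supremum of distances, which is a maximum on finite nonempty sets.\<close>

definition min_semi_general_diameter :: "nat \<Rightarrow> real" where
  "min_semi_general_diameter n =
     (LEAST d. d \<in> diameter ` semi_general_integral_point_sets n)"

end

theory Submission
  imports Defs
begin

text \<open>Let \<open>M\<close> be a set of \<open>n\<close> points at integer distances, no three of them collinear, with
  diameter \<open>d\<close>. Up to constants, two opposing estimates give \<open>n \<le> d powr (4/5)\<close>.

  First, \<open>M\<close> contains a short distance. A non-degenerate triangle with integer sides of length
  at least \<open>m\<close> cannot be flat: two sides together exceed the third by at least 1, which forces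
  every height to be at least \<open>sqrt (m - 1/4)\<close>. So a strip of smaller width contains at most two
  points (\<open>narrow_strip_card\<close>), and covering \<open>M\<close> by about \<open>d / sqrt m\<close> strips shows
  that the smallest distance is at most a constant times \<open>d\<^sup>2 / n\<^sup>2\<close>
  (\<open>minimum_distance_bound\<close>). The same holds after removing one end of a closest pair, which
  yields two short segments on different lines.

  Second, two short segments on different lines bound \<open>n\<close>. The difference of the distances to
  the ends of a segment of length \<open>a\<close> is an integer less than \<open>a\<close> in absolute value, so the
  other points lie on fewer than \<open>2 * a\<close> branches of hyperbolas whose foci are these ends,
  the perpendicular bisector included. Two such
  branches for different lines share at most four points of \<open>M\<close>
  (\<open>hyperbolas_intersection_card\<close>), because five points with no three collinear determine a conic
  (\<open>five_points_pencil\<close>) and a conic determines the line through its foci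
  (\<open>proportional_conics_same_axis\<close>). Hence \<open>n\<close> is at most 16 times the product of the two
  lengths (\<open>hyperbola_classes_card\<close>).

  Together, \<open>n\<close> is at most a constant times \<open>d ^ 4 / n ^ 4\<close>, and the constants suffice for
  \<open>n ^ 5 \<le> 5 ^ 5 * d ^ 4\<close> (\<open>card_power_le_diameter_power\<close>).

  The minimal diameter is attained because the diameters are natural numbers and admissible sets
  exist for every \<open>n \<ge> 3\<close>: take rational points at rational distances on a circle and scale
  (\<open>semi_general_integral_point_set_exists\<close>).\<close>

section \<open>Collinearity in the plane\<close>

lemma collinear_3_plane:
  fixes A B C :: "real ^ 2"
  shows "collinear {A, B, C} \<longleftrightarrow> (B$1 - A$1) * (C$2 - A$2) = (B$2 - A$2) * (C$1 - A$1)"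
    (is "?L \<longleftrightarrow> ?R")
proof
  assume ?L
  then obtain u where u: "\<And>x y. x \<in> {A,B,C} \<Longrightarrow> y \<in> {A,B,C} \<Longrightarrow> \<exists>c. x - y = c *\<^sub>R u"
    unfolding collinear_def by blast
  obtain b where b: "B - A = b *\<^sub>R u" using u[of B A] by auto
  obtain c where c: "C - A = c *\<^sub>R u" using u[of C A] by auto
  have "B$k - A$k = b * u$k" "C$k - A$k = c * u$k" for k
    using arg_cong[OF b, of "\<lambda>v. v$k"] arg_cong[OF c, of "\<lambda>v. v$k"] by simp_all
  then show ?R by simp
next
  assume R: ?R
  show ?L
  proof (cases "A = B")
    case True then show ?thesis by simp
  next
    case False
    then have "\<exists>k. C - A = k *\<^sub>R (B - A)"
    proof -
      have "B$1 - A$1 \<noteq> 0 \<or> B$2 - A$2 \<noteq> 0"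
        using False by (auto simp: vec_eq_iff forall_2)
      then show ?thesis
      proof
        assume n: "B$1 - A$1 \<noteq> 0"
        define k where "k = (C$1 - A$1) / (B$1 - A$1)"
        have k: "C$1 - A$1 = k * (B$1 - A$1)" using n by (simp add: k_def)
        then have "(B$1 - A$1) * (C$2 - A$2 - k * (B$2 - A$2)) = 0" using R by algebra
        then have "C - A = k *\<^sub>R (B - A)"
          using n k by (simp add: vec_eq_iff forall_2)
        then show ?thesis ..
      next
        assume n: "B$2 - A$2 \<noteq> 0"
        define k where "k = (C$2 - A$2) / (B$2 - A$2)"
        have k: "C$2 - A$2 = k * (B$2 - A$2)" using n by (simp add: k_def)
        then have "(B$2 - A$2) * (C$1 - A$1 - k * (B$1 - A$1)) = 0" using R by algebra
        then have "C - A = k *\<^sub>R (B - A)"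
          using n k by (simp add: vec_eq_iff forall_2)
        then show ?thesis ..
      qed
    qed
    then have "collinear {0, B - A, C - A}" by (auto simp: collinear_lemma)
    then have "collinear {B, A, C}" using collinear_3[of B A C] by (simp add: NO_MATCH_def)
    then show ?thesis by (simp add: insert_commute)
  qed
qed

lemma semi_general_position_subset:
  "semi_general_position M \<Longrightarrow> S \<subseteq> M \<Longrightarrow> semi_general_position S"
  unfolding semi_general_position_def by blast

lemma semi_general_positionD:
  "semi_general_position M \<Longrightarrow> {A, B, C} \<subseteq> M \<Longrightarrow> A \<noteq> B \<Longrightarrow> A \<noteq> C \<Longrightarrow> B \<noteq> C
    \<Longrightarrow> \<not> collinear {A, B, C}"
  unfolding semi_general_position_def by blast

text \<open>Cramer's rule: the sides at a vertex of a non-degenerate triangle form a basis.\<close>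

lemma coordinates_wrt_triangle:
  fixes A B C P :: "real ^ 2"
  assumes "\<not> collinear {A, B, C}"
  obtains x y where "P = A + x *\<^sub>R (B - A) + y *\<^sub>R (C - A)"
proof -
  define D where "D = (B$1 - A$1) * (C$2 - A$2) - (B$2 - A$2) * (C$1 - A$1)"
  have D: "D \<noteq> 0" using assms by (simp add: collinear_3_plane D_def)
  define x where "x = ((P$1 - A$1) * (C$2 - A$2) - (P$2 - A$2) * (C$1 - A$1)) / D"
  define y where "y = ((B$1 - A$1) * (P$2 - A$2) - (B$2 - A$2) * (P$1 - A$1)) / D"
  have "x * D = (P$1 - A$1) * (C$2 - A$2) - (P$2 - A$2) * (C$1 - A$1)"
       "y * D = (B$1 - A$1) * (P$2 - A$2) - (B$2 - A$2) * (P$1 - A$1)"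
    using D by (simp_all add: x_def y_def)
  then have "(P$1 - (A$1 + x * (B$1 - A$1) + y * (C$1 - A$1))) * D = 0"
            "(P$2 - (A$2 + x * (B$2 - A$2) + y * (C$2 - A$2))) * D = 0"
    unfolding D_def by algebra+
  then have "P = A + x *\<^sub>R (B - A) + y *\<^sub>R (C - A)"
    using D by (simp add: vec_eq_iff forall_2)
  then show ?thesis by (rule that)
qed

section \<open>Pencils of conics\<close>

text \<open>This is "polynomial of degree at most 2" without reference to coordinates: the restriction to
  every affine frame \<open>p, e, f\<close> is such a polynomial in the two coordinates. The vertices of
  any triangle can then serve as the frame.\<close>

definition quadratic :: "('a::real_vector \<Rightarrow> real) \<Rightarrow> bool" where
  "quadratic q \<longleftrightarrow> (\<forall>p e f. \<exists>a b c d g k. \<forall>x y.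
     q (p + x *\<^sub>R e + y *\<^sub>R f) = a * x\<^sup>2 + b * x * y + c * y\<^sup>2 + d * x + g * y + k)"

lemma quadratic_combination:
  assumes "quadratic q" "quadratic r"
  shows "quadratic (\<lambda>P. s * q P + t * r P)"
  unfolding quadratic_def
proof (intro allI)
  fix p e f
  obtain a b c d g k where q: "\<And>x y. q (p + x *\<^sub>R e + y *\<^sub>R f)
      = a * x\<^sup>2 + b * x * y + c * y\<^sup>2 + d * x + g * y + k"
    using assms(1) unfolding quadratic_def by metis
  obtain a' b' c' d' g' k' where r: "\<And>x y. r (p + x *\<^sub>R e + y *\<^sub>R f)
      = a' * x\<^sup>2 + b' * x * y + c' * y\<^sup>2 + d' * x + g' * y + k'"
    using assms(2) unfolding quadratic_def by metis
  show "\<exists>a b c d g k. \<forall>x y. s * q (p + x *\<^sub>R e + y *\<^sub>R f) + t * r (p + x *\<^sub>R e + y *\<^sub>R f)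
      = a * x\<^sup>2 + b * x * y + c * y\<^sup>2 + d * x + g * y + k"
    by (rule exI[of _ "s*a+t*a'"], rule exI[of _ "s*b+t*b'"], rule exI[of _ "s*c+t*c'"],
        rule exI[of _ "s*d+t*d'"], rule exI[of _ "s*g+t*g'"], rule exI[of _ "s*k+t*k'"])
       (intro allI, simp only: q r, simp add: algebra_simps)
qed

text \<open>The zero set of \<open>conic A u \<alpha>\<close> contains the points whose distance to the focus \<open>A\<close> is
  the affine function \<open>u \<bullet> P + \<alpha>\<close>; the line where that function vanishes is the
  directrix.\<close>

definition conic :: "'a::real_inner \<Rightarrow> 'a \<Rightarrow> real \<Rightarrow> 'a \<Rightarrow> real" where
  "conic A u \<alpha> P = (dist P A)\<^sup>2 - (u \<bullet> P + \<alpha>)\<^sup>2"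

lemma conic_expand:
  "conic A u \<alpha> P = P \<bullet> P - 2 * (A \<bullet> P) + A \<bullet> A - (u \<bullet> P + \<alpha>)\<^sup>2"
  by (simp add: conic_def dist_norm power2_norm_eq_inner inner_diff inner_commute)

lemma quadratic_conic: "quadratic (conic A u \<alpha>)"
  unfolding quadratic_def
proof (intro allI)
  fix p e f
  show "\<exists>a b c d g k. \<forall>x y. conic A u \<alpha> (p + x *\<^sub>R e + y *\<^sub>R f)
      = a * x\<^sup>2 + b * x * y + c * y\<^sup>2 + d * x + g * y + k"
    by (rule exI[of _ "e \<bullet> e - (u \<bullet> e)\<^sup>2"], rule exI[of _ "2 * (e \<bullet> f) - 2 * (u \<bullet> e) * (u \<bullet> f)"],
        rule exI[of _ "f \<bullet> f - (u \<bullet> f)\<^sup>2"],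
        rule exI[of _ "2 * (p \<bullet> e) - 2 * (A \<bullet> e) - 2 * (u \<bullet> e) * (u \<bullet> p + \<alpha>)"],
        rule exI[of _ "2 * (p \<bullet> f) - 2 * (A \<bullet> f) - 2 * (u \<bullet> f) * (u \<bullet> p + \<alpha>)"],
        rule exI[of _ "conic A u \<alpha> p"])
       (simp add: conic_expand inner_simps inner_commute algebra_simps power2_eq_square)
qed

text \<open>Five points with no three collinear determine a conic. On the line through \<open>P1\<close> and
  \<open>P2\<close> two quadratics already share two zeros; a combination that also vanishes at a third point
  of this line vanishes on all of it, so it is the product of the equation of the line and a second
  affine function. The latter vanishes at the non-collinear points \<open>P3\<close>, \<open>P4\<close>,
  \<open>P5\<close>, hence identically.\<close>

lemma five_points_pencil:
  fixes q r :: "real ^ 2 \<Rightarrow> real"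
  assumes qr: "quadratic q" "quadratic r"
    and pos: "semi_general_position {P1, P2, P3, P4, P5}"
    and dist: "distinct [P1, P2, P3, P4, P5]"
    and zero: "\<And>P. P \<in> {P1, P2, P3, P4, P5} \<Longrightarrow> q P = 0 \<and> r P = 0"
  obtains s t where "s \<noteq> 0 \<or> t \<noteq> 0" "\<And>P. s * q P + t * r P = 0"
proof -
  \<comment> \<open>The third zero on the line through \<open>P1\<close> and \<open>P2\<close>.\<close>
  define X where "X = P1 + (1/2) *\<^sub>R (P2 - P1)"
  obtain s t where st: "s \<noteq> 0 \<or> t \<noteq> 0" and X: "s * q X + t * r X = 0"
  proof (cases "q X = 0 \<and> r X = 0")
    case True then show ?thesis using that[of 1 0] by simp
  next
    case False then show ?thesis using that[of "r X" "- q X"] by (auto simp: mult.commute)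
  qed
  define F where "F P = s * q P + t * r P" for P
  have "quadratic F" unfolding F_def using qr by (rule quadratic_combination)
  then obtain a b c d g k where F: "\<And>x y. F (P1 + x *\<^sub>R (P2 - P1) + y *\<^sub>R (P3 - P1))
      = a * x\<^sup>2 + b * x * y + c * y\<^sup>2 + d * x + g * y + k"
    unfolding quadratic_def by metis
  have F0: "F P = 0" if "P \<in> {P1, P2, P3, P4, P5}" for P
    using zero[OF that] by (simp add: F_def)
  have nc: "\<not> collinear {P1, P2, P3}" "\<not> collinear {P1, P2, P4}" "\<not> collinear {P1, P2, P5}"
      "\<not> collinear {P3, P4, P5}"
    by (rule semi_general_positionD[OF pos]; use dist in auto)+
  have k: "k = 0" using F[of 0 0] F0[of P1] by simp
  have "a + d = 0" using F[of 1 0] F0[of P2] k by simp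
  moreover have "a / 4 + d / 2 = 0"
    using F[of "1/2" 0] X k by (simp add: F_def X_def power2_eq_square)
  ultimately have ad: "a = 0" "d = 0" by simp_all
  have cg: "c + g = 0" using F[of 0 1] F0[of P3] k by simp
  obtain x4 y4 where P4: "P4 = P1 + x4 *\<^sub>R (P2 - P1) + y4 *\<^sub>R (P3 - P1)"
    using coordinates_wrt_triangle[OF nc(1)] .
  obtain x5 y5 where P5: "P5 = P1 + x5 *\<^sub>R (P2 - P1) + y5 *\<^sub>R (P3 - P1)"
    using coordinates_wrt_triangle[OF nc(1)] .
  \<comment> \<open>In the frame at \<open>P1\<close>, the combination is \<open>y * (b * x + c * (y - 1))\<close>, and
    \<open>y = 0\<close> is the line through \<open>P1\<close> and \<open>P2\<close>.\<close>
  have y4: "y4 \<noteq> 0" using nc(2) unfolding collinear_3_plane P4 by auto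
  have y5: "y5 \<noteq> 0" using nc(3) unfolding collinear_3_plane P5 by auto
  have "y4 * (b * x4 + c * (y4 - 1)) = 0"
    using F[of x4 y4] F0[of P4] cg ad k unfolding P4[symmetric] by (simp) algebra
  then have e4: "b * x4 + c * (y4 - 1) = 0" using y4 by simp
  have "y5 * (b * x5 + c * (y5 - 1)) = 0"
    using F[of x5 y5] F0[of P5] cg ad k unfolding P5[symmetric] by (simp) algebra
  then have e5: "b * x5 + c * (y5 - 1) = 0" using y5 by simp
  have det: "x4 * (y5 - 1) - x5 * (y4 - 1) \<noteq> 0"
  proof
    assume 0: "x4 * (y5 - 1) - x5 * (y4 - 1) = 0"
    have "(P4$1 - P3$1) * (P5$2 - P3$2) - (P4$2 - P3$2) * (P5$1 - P3$1)
       = (x4 * (y5 - 1) - x5 * (y4 - 1)) *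
         ((P2$1 - P1$1) * (P3$2 - P1$2) - (P2$2 - P1$2) * (P3$1 - P1$1))"
      by (simp add: P4 P5 algebra_simps)
    then show False using nc(4) 0 by (simp add: collinear_3_plane)
  qed
  have "b * (x4 * (y5 - 1) - x5 * (y4 - 1)) = 0" "c * (x4 * (y5 - 1) - x5 * (y4 - 1)) = 0"
    using e4 e5 by algebra+
  then have bc: "b = 0" "c = 0" using det by simp_all
  have "F P = 0" for P
  proof -
    obtain x y where "P = P1 + x *\<^sub>R (P2 - P1) + y *\<^sub>R (P3 - P1)"
      using coordinates_wrt_triangle[OF nc(1)] .
    then show ?thesis using F ad bc cg k by simp
  qed
  then show ?thesis using that st by (simp add: F_def)
qed

text \<open>A conic determines its focal axis. Comparing the parts of degree 2 of a vanishing combination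
  with coefficients \<open>s\<close> and \<open>t\<close> shows that if \<open>s + t \<noteq> 0\<close>, then
  \<open>s\<close> and \<open>t\<close> have the same sign and the two directrices intersect (this is the
  case of a hyperbola and its conjugate). At the intersection point both functions are squares of
  distances to the foci \<open>A\<close> and \<open>C\<close>, so both distances vanish and \<open>A\<close> lies on
  its own directrix, which is excluded by
  \<open>u \<bullet> A + \<alpha> \<noteq> 0\<close>. If \<open>s + t = 0\<close>, then the two functions agree and so do
  the directions of their axes; the part of degree 1 puts \<open>C - A\<close> into the same
  direction.\<close>

lemma proportional_conics_same_axis:
  fixes A C u v :: "real ^ 2"
  assumes st: "s \<noteq> 0 \<or> t \<noteq> 0"
    and zero: "\<And>P. s * conic A u \<alpha> P + t * conic C v \<beta> P = 0"
    and A: "u \<bullet> A + \<alpha> \<noteq> 0"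
  shows "u = v \<or> u = - v" "\<exists>c. C - A = c *\<^sub>R u"
proof -
  \<comment> \<open>The even part of the combination minus its value at the origin, then the odd part.\<close>
  have quad: "(s + t) * (P \<bullet> P) = s * (u \<bullet> P)\<^sup>2 + t * (v \<bullet> P)\<^sup>2" for P
    using zero[of P] zero[of "-P"] zero[of 0]
    by (simp add: conic_expand power2_eq_square algebra_simps)
  have lin: "s * (A \<bullet> P + \<alpha> * (u \<bullet> P)) + t * (C \<bullet> P + \<beta> * (v \<bullet> P)) = 0" for P
    using zero[of P] zero[of "-P"]
    by (simp add: conic_expand power2_eq_square algebra_simps)
  define rot where "rot w = (vector [- w$2, w$1] :: real^2)" for w :: "real^2"
  have rot: "w \<bullet> rot w = 0" "rot w = 0 \<longleftrightarrow> w = 0" for w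
    by (auto simp: rot_def inner_vec_def sum_2 vec_eq_iff forall_2)
  have perp: "\<exists>p. p \<noteq> 0 \<and> w \<bullet> p = 0" for w :: "real^2"
  proof (cases "w = 0")
    case True
    then show ?thesis by (intro exI[of _ "axis 1 1"]) (simp add: axis_eq_0_iff)
  next
    case False then show ?thesis using rot[of w] by blast
  qed
  have "s + t = 0"
  proof (rule ccontr)
    assume n: "s + t \<noteq> 0"
    obtain p where p: "p \<noteq> 0" "u \<bullet> p = 0" using perp by blast
    obtain p' where p': "p' \<noteq> 0" "v \<bullet> p' = 0" using perp by blast
    have pp: "p \<bullet> p > 0" "p' \<bullet> p' > 0" using p p' by simp_all
    have ep: "(s + t) * (p \<bullet> p) = t * (v \<bullet> p)\<^sup>2" using quad[of p] p by simp
    have ep': "(s + t) * (p' \<bullet> p') = s * (u \<bullet> p')\<^sup>2" using quad[of p'] p' by simp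
    have "t * (s + t) > 0"
    proof -
      have "(s + t)^2 * (p \<bullet> p) = t * (s + t) * (v \<bullet> p)\<^sup>2" using ep by algebra
      moreover have "(s + t)^2 * (p \<bullet> p) > 0" using n pp by simp
      ultimately show ?thesis by (metis zero_less_mult_pos2 zero_le_power2 not_less mult_nonpos_nonneg)
    qed
    moreover have "s * (s + t) > 0"
    proof -
      have "(s + t)^2 * (p' \<bullet> p') = s * (s + t) * (u \<bullet> p')\<^sup>2" using ep' by algebra
      moreover have "(s + t)^2 * (p' \<bullet> p') > 0" using n pp by simp
      ultimately show ?thesis by (metis zero_less_mult_pos2 zero_le_power2 not_less mult_nonpos_nonneg)
    qed
    ultimately have sg: "s > 0 \<and> t > 0 \<or> s < 0 \<and> t < 0"
      by (smt (verit) mult_less_0_iff zero_less_mult_iff)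
    define D where "D = u$1 * v$2 - u$2 * v$1"
    have D: "D \<noteq> 0"
    proof
      assume D0: "D = 0"
      have "v \<bullet> rot u = 0 \<and> u \<bullet> rot v = 0"
        using D0 by (simp add: D_def rot_def inner_vec_def sum_2 algebra_simps)
      then have "(s + t) * (rot u \<bullet> rot u) = 0" "(s + t) * (rot v \<bullet> rot v) = 0"
        using quad[of "rot u"] quad[of "rot v"] rot(1) by simp_all
      then have "u = 0" "v = 0" using n rot(2) by simp_all
      then show False using ep n pp by simp
    qed
    \<comment> \<open>The intersection of the directrices.\<close>
    define Q where "Q = (vector [(\<beta> * u$2 - \<alpha> * v$2) / D, (\<alpha> * v$1 - \<beta> * u$1) / D] :: real^2)"
    have Q: "u \<bullet> Q + \<alpha> = 0" "v \<bullet> Q + \<beta> = 0"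
    proof -
      have "D * (Q$1) = \<beta> * u$2 - \<alpha> * v$2" "D * (Q$2) = \<alpha> * v$1 - \<beta> * u$1"
        using D by (simp_all add: Q_def)
      then have "D * (u$1 * Q$1 + u$2 * Q$2 + \<alpha>) = 0" "D * (v$1 * Q$1 + v$2 * Q$2 + \<beta>) = 0"
        unfolding D_def by algebra+
      then show "u \<bullet> Q + \<alpha> = 0" "v \<bullet> Q + \<beta> = 0"
        using D by (simp_all add: inner_vec_def sum_2)
    qed
    have e: "s * (dist Q A)\<^sup>2 + t * (dist Q C)\<^sup>2 = 0" using zero[of Q] Q by (simp add: conic_def)
    have "dist Q A = 0"
    proof (rule ccontr)
      assume "dist Q A \<noteq> 0"
      then have "(dist Q A)\<^sup>2 > 0" "(dist Q C)\<^sup>2 \<ge> 0" by simp_all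
      then show False using e sg
        by (smt (verit) mult_pos_pos mult_nonneg_nonneg mult_neg_pos mult_nonpos_nonneg)
    qed
    then show False using Q A by simp
  qed
  then have t: "t = - s" and s: "s \<noteq> 0" using st by auto
  have sq: "(u \<bullet> P)\<^sup>2 = (v \<bullet> P)\<^sup>2" for P using quad[of P] t s by simp
  show uv: "u = v \<or> u = - v"
  proof -
    have "(u \<bullet> u)\<^sup>2 = (u \<bullet> v)\<^sup>2" "(u \<bullet> v)\<^sup>2 = (v \<bullet> v)\<^sup>2"
      using sq[of u] sq[of v] by (simp_all add: inner_commute)
    then have "(u \<bullet> u)\<^sup>2 = (v \<bullet> v)\<^sup>2" "u \<bullet> u = u \<bullet> v \<or> u \<bullet> u = - (u \<bullet> v)"
      using power2_eq_iff by metis+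
    then have "u \<bullet> u = v \<bullet> v" "u \<bullet> u = u \<bullet> v \<or> u \<bullet> u = - (u \<bullet> v)"
      by (simp_all add: power2_eq_iff_nonneg)
    then have "(u - v) \<bullet> (u - v) = 0 \<or> (u + v) \<bullet> (u + v) = 0"
      by (auto simp: inner_simps inner_commute)
    then show ?thesis by (auto simp: add_eq_0_iff2)
  qed
  have "(C - A) \<bullet> P = (\<alpha> *\<^sub>R u - \<beta> *\<^sub>R v) \<bullet> P" for P
  proof -
    have "s * ((C - A) \<bullet> P - (\<alpha> *\<^sub>R u - \<beta> *\<^sub>R v) \<bullet> P) = 0"
      using lin[of P] t by (simp add: inner_simps algebra_simps)
    then show ?thesis using s by simp
  qed
  then have "C - A = \<alpha> *\<^sub>R u - \<beta> *\<^sub>R v" by (metis vector_eq_rdot)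
  then have "C - A = (\<alpha> - \<beta>) *\<^sub>R u \<or> C - A = (\<alpha> + \<beta>) *\<^sub>R u"
    using uv by (auto simp: scaleR_left_distrib scaleR_left_diff_distrib)
  then show "\<exists>c. C - A = c *\<^sub>R u" by blast
qed

section \<open>Intersections of two families of hyperbolas\<close>

lemma obtain_three:
  assumes "\<not> card S \<le> 2"
  obtains A B C where "{A, B, C} \<subseteq> S" "A \<noteq> B" "A \<noteq> C" "B \<noteq> C"
proof -
  have "3 \<le> card S" using assms by simp
  then obtain T where "T \<subseteq> S" "card T = 3" using obtain_subset_with_card_n by metis
  then show ?thesis using that card_3_iff[of T] by metis
qed

lemma card_le_fibers:
  assumes "finite S" "finite T" "f ` S \<subseteq> T" "\<And>k. k \<in> T \<Longrightarrow> card {x \<in> S. f x = k} \<le> L"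
  shows "card S \<le> L * card T"
proof -
  have "S = (\<Union>k\<in>T. {x \<in> S. f x = k})" using assms(3) by blast
  then have "card S \<le> (\<Sum>k\<in>T. card {x \<in> S. f x = k})"
    using card_UN_le[OF assms(2), of "\<lambda>k. {x \<in> S. f x = k}"] by simp
  also have "\<dots> \<le> (\<Sum>k\<in>T. L)" by (rule sum_mono) (rule assms(4))
  finally show ?thesis by (simp add: mult.commute)
qed

lemma perpendicular_bisector_card:
  fixes A B :: "real ^ 2"
  assumes "A \<noteq> B" and pos: "semi_general_position S"
    and eq: "\<And>P. P \<in> S \<Longrightarrow> dist P A = dist P B"
  shows "card S \<le> 2"
proof (rule ccontr)
  assume "\<not> card S \<le> 2"
  then obtain P Q R where PQR: "{P, Q, R} \<subseteq> S" "P \<noteq> Q" "P \<noteq> R" "Q \<noteq> R" by (rule obtain_three)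
  define w where "w = B - A"
  have "w \<bullet> (X - Y) = 0" if "X \<in> S" "Y \<in> S" for X Y
  proof -
    have "2 * (w \<bullet> X) = B \<bullet> B - A \<bullet> A" if "X \<in> S" for X
    proof -
      have "(dist X A)\<^sup>2 = (dist X B)\<^sup>2" using eq[OF that] by simp
      then show ?thesis
        by (simp add: w_def dist_norm power2_norm_eq_inner inner_simps inner_commute)
    qed
    from this[OF that(1)] this[OF that(2)] show ?thesis by (simp add: inner_diff_right)
  qed
  then have "w$1 * (Q$1 - P$1) + w$2 * (Q$2 - P$2) = 0" "w$1 * (R$1 - P$1) + w$2 * (R$2 - P$2) = 0"
    using PQR(1) by (auto simp: inner_vec_def sum_2)
  then have "w$1 * ((Q$1 - P$1) * (R$2 - P$2) - (Q$2 - P$2) * (R$1 - P$1)) = 0"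
     "w$2 * ((Q$1 - P$1) * (R$2 - P$2) - (Q$2 - P$2) * (R$1 - P$1)) = 0" by algebra+
  moreover have "w$1 \<noteq> 0 \<or> w$2 \<noteq> 0" using assms(1) by (auto simp: w_def vec_eq_iff forall_2)
  ultimately have "collinear {P, Q, R}" by (auto simp: collinear_3_plane)
  then show False using semi_general_positionD[OF pos PQR] by simp
qed

text \<open>On a branch of a hyperbola the distance to a focus is an affine function of the point: the
  difference of the squared distances to the foci is affine, and it is the product of the constant
  \<open>i\<close> and the sum of the distances, so the sum of the distances is affine as well.\<close>

lemma hyperbola_branch_conic:
  assumes "dist P A - dist P B = i" "i \<noteq> 0"
  shows "conic A ((1 / i) *\<^sub>R (B - A)) ((A \<bullet> A - B \<bullet> B + i\<^sup>2) / (2 * i)) P = 0"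
proof -
  have "2 * i * dist P A = (dist P A)\<^sup>2 - (dist P B)\<^sup>2 + i\<^sup>2"
    unfolding assms(1)[symmetric] by (simp add: power2_eq_square algebra_simps)
  also have "\<dots> = 2 * ((B - A) \<bullet> P) + (A \<bullet> A - B \<bullet> B + i\<^sup>2)"
    by (simp add: dist_norm power2_norm_eq_inner inner_simps inner_commute)
  finally have "dist P A = ((B - A) \<bullet> P) / i + (A \<bullet> A - B \<bullet> B + i\<^sup>2) / (2 * i)"
    using assms(2) by (simp add: field_simps)
  then have "dist P A = ((1 / i) *\<^sub>R (B - A)) \<bullet> P + (A \<bullet> A - B \<bullet> B + i\<^sup>2) / (2 * i)"
    by (simp only: inner_scaleR_left) simp
  then show ?thesis by (simp add: conic_def)
qed

text \<open>This is the bound of Bezout for two conics. Five common points would make the two conics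
  proportional, so that all four foci would lie on one line. For \<open>i = 0\<close> or \<open>j = 0\<close> the
  branch degenerates to a perpendicular bisector, which carries at most two points of
  \<open>S\<close>.\<close>

lemma hyperbolas_intersection_card:
  fixes A B C D :: "real ^ 2"
  assumes i: "\<bar>i\<bar> < dist A B" and j: "\<bar>j\<bar> < dist C D"
    and lines: "\<not> (collinear {A, B, C} \<and> collinear {A, B, D})"
    and pos: "semi_general_position S"
    and S: "\<And>P. P \<in> S \<Longrightarrow> dist P A - dist P B = i \<and> dist P C - dist P D = j"
  shows "card S \<le> 4"
proof (cases "i = 0 \<or> j = 0")
  case True
  have ne: "A \<noteq> B" "C \<noteq> D" using i j by auto
  from True have "card S \<le> 2"
    using perpendicular_bisector_card[OF ne(1) pos] perpendicular_bisector_card[OF ne(2) pos] S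
    by force
  then show ?thesis by simp
next
  case False
  then have i0: "i \<noteq> 0" and j0: "j \<noteq> 0" by auto
  show ?thesis
  proof (rule ccontr)
    assume "\<not> card S \<le> 4"
    then have "5 \<le> card S" by simp
    then obtain T where T: "T \<subseteq> S" "card T = 5" using obtain_subset_with_card_n by metis
    then have "finite T" by (metis card.infinite zero_neq_numeral)
    then obtain xs where xs: "set xs = T" "distinct xs" using finite_distinct_list by metis
    then have "length xs = 5" using T(2) distinct_card by metis
    then obtain P1 P2 P3 P4 P5 where xs5: "xs = [P1, P2, P3, P4, P5]"
      by (auto simp: numeral_eq_Suc length_Suc_conv)
    define u where "u = (1 / i) *\<^sub>R (B - A)"
    define v where "v = (1 / j) *\<^sub>R (D - C)"
    define \<alpha> where "\<alpha> = (A \<bullet> A - B \<bullet> B + i\<^sup>2) / (2 * i)"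
    define \<beta> where "\<beta> = (C \<bullet> C - D \<bullet> D + j\<^sup>2) / (2 * j)"
    have five: "{P1, P2, P3, P4, P5} \<subseteq> S" using T(1) xs xs5 by simp
    have zero: "conic A u \<alpha> P = 0 \<and> conic C v \<beta> P = 0" if "P \<in> {P1, P2, P3, P4, P5}" for P
      unfolding u_def v_def \<alpha>_def \<beta>_def
      using hyperbola_branch_conic[OF _ i0] hyperbola_branch_conic[OF _ j0] S five that by blast
    obtain s t where st: "s \<noteq> 0 \<or> t \<noteq> 0" "\<And>P. s * conic A u \<alpha> P + t * conic C v \<beta> P = 0"
      using five_points_pencil[OF quadratic_conic quadratic_conic
          semi_general_position_subset[OF pos five] _ zero] xs(2) xs5 by metis
    have "u \<bullet> A + \<alpha> \<noteq> 0"
    proof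
      assume "u \<bullet> A + \<alpha> = 0"
      moreover have "2 * i * (u \<bullet> A + \<alpha>) = i\<^sup>2 - (B - A) \<bullet> (B - A)"
        using i0 by (simp add: u_def \<alpha>_def field_simps inner_simps inner_commute power2_eq_square)
      ultimately have "i\<^sup>2 = (B - A) \<bullet> (B - A)" by simp
      then have "i\<^sup>2 = (dist A B)\<^sup>2"
        by (simp add: dist_norm power2_norm_eq_inner norm_minus_commute[of A])
      then have "\<bar>i\<bar> = \<bar>dist A B\<bar>" by (metis power2_abs abs_ge_zero power2_eq_iff_nonneg)
      then show False using i by simp
    qed
    from proportional_conics_same_axis[OF st this]
    obtain c where uv: "u = v \<or> u = - v" and C: "C - A = c *\<^sub>R u" by blast
    have B: "B = A + i *\<^sub>R u" and D: "D = C + j *\<^sub>R v" using i0 j0 by (simp_all add: u_def v_def)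
    have C': "C = A + c *\<^sub>R u" using C by (simp add: algebra_simps)
    have "\<exists>c'. D = A + c' *\<^sub>R u"
      using uv
    proof
      assume "u = v"
      then have "D = A + (c + j) *\<^sub>R u" by (simp add: D C' algebra_simps)
      then show ?thesis ..
    next
      assume "u = - v"
      then have "v = - u" by simp
      then have "D = A + (c - j) *\<^sub>R u" unfolding D C' by (simp add: algebra_simps)
      then show ?thesis ..
    qed
    then obtain c' where D': "D = A + c' *\<^sub>R u" ..
    have "collinear {A, B, C} \<and> collinear {A, B, D}"
      unfolding collinear_3_plane B C' D' by simp
    then show False using lines by simp
  qed
qed

lemma triangle_inequality_strict:
  fixes A B C :: "'a::euclidean_space"
  assumes "\<not> collinear {A, B, C}"
  shows "dist A C < dist A B + dist B C"
proof -
  have "\<not> between (A, C) B" using assms between_imp_collinear by metis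
  then show ?thesis using dist_triangle[of A C B] by (simp add: between less_le)
qed

text \<open>Outside the two pairs, the differences of the distances to \<open>A, B\<close> and to \<open>C, D\<close>
  are integers that are, by the strict triangle inequality, smaller in absolute value than
  \<open>a = dist A B\<close> and \<open>c = dist C D\<close>. This gives at most \<open>(2 * a - 1) * (2 * c - 1)\<close>
  pairs of branches, each with at most four points, and \<open>4 * (2 * a - 1) * (2 * c - 1) + 4\<close> is
  at most \<open>16 * a * c\<close>.\<close>

lemma hyperbola_classes_card:
  fixes A B C D :: "real ^ 2"
  assumes fin: "finite M" and int: "\<And>P Q. P \<in> M \<Longrightarrow> Q \<in> M \<Longrightarrow> dist P Q \<in> \<int>"
    and pos: "semi_general_position M"
    and ABCD: "{A, B, C, D} \<subseteq> M" "A \<noteq> B" "C \<noteq> D" "A \<noteq> C" "A \<noteq> D"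
  shows "real (card M) \<le> 16 * dist A B * dist C D"
proof -
  have inM: "A \<in> M" "B \<in> M" "C \<in> M" "D \<in> M" using ABCD(1) by auto
  obtain a where a: "dist A B = of_int a" using int[OF inM(1,2)] by (auto elim: Ints_cases)
  obtain c where c: "dist C D = of_int c" using int[OF inM(3,4)] by (auto elim: Ints_cases)
  have "real_of_int a > 0" "real_of_int c > 0" using ABCD a c by (metis zero_less_dist_iff)+
  then have ac: "a \<ge> 1" "c \<ge> 1" by simp_all
  define S where "S = M - {A, B, C, D}"
  define T where "T = {- (a - 1)..a - 1} \<times> {- (c - 1)..c - 1}"
  define f where "f P = (\<lfloor>dist P A - dist P B\<rfloor>, \<lfloor>dist P C - dist P D\<rfloor>)" for P
  \<comment> \<open>The pairs may share the point \<open>B\<close>, so that only one of the two triples need consist of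
    three points.\<close>
  have lines: "\<not> (collinear {A, B, C} \<and> collinear {A, B, D})"
  proof (cases "B = C")
    case True
    then show ?thesis using semi_general_positionD[OF pos, of A B D] ABCD by auto
  next
    case False
    then show ?thesis using semi_general_positionD[OF pos, of A B C] ABCD by auto
  qed
  have floor: "real_of_int \<lfloor>dist P X - dist P Y\<rfloor> = dist P X - dist P Y"
    if "P \<in> M" "X \<in> M" "Y \<in> M" for P X Y
    using int[OF that(1,2)] int[OF that(1,3)] by (metis Ints_cases Ints_diff floor_of_int)
  have strict: "\<bar>dist P X - dist P Y\<bar> < dist X Y"
    if "{P, X, Y} \<subseteq> M" "P \<noteq> X" "P \<noteq> Y" "X \<noteq> Y" for P X Y
  proof -
    have nc: "\<not> collinear {P, X, Y}" using semi_general_positionD[OF pos that] .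
    then have "\<not> collinear {P, Y, X}" by (simp add: insert_commute)
    from triangle_inequality_strict[OF this] triangle_inequality_strict[OF nc]
    show ?thesis by (simp add: dist_commute)
  qed
  have "f ` S \<subseteq> T"
  proof
    fix z assume "z \<in> f ` S"
    then obtain P where P: "P \<in> S" "z = f P" by blast
    have PM: "P \<in> M" "P \<noteq> A" "P \<noteq> B" "P \<noteq> C" "P \<noteq> D" using P(1) by (auto simp: S_def)
    have "\<bar>real_of_int \<lfloor>dist P A - dist P B\<rfloor>\<bar> < of_int a"
      unfolding floor[OF PM(1) inM(1,2)] a[symmetric] by (rule strict) (use PM inM ABCD in auto)
    moreover have "\<bar>real_of_int \<lfloor>dist P C - dist P D\<rfloor>\<bar> < of_int c"
      unfolding floor[OF PM(1) inM(3,4)] c[symmetric] by (rule strict) (use PM inM ABCD in auto)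
    ultimately have "\<bar>\<lfloor>dist P A - dist P B\<rfloor>\<bar> < a" "\<bar>\<lfloor>dist P C - dist P D\<rfloor>\<bar> < c" by linarith+
    then show "z \<in> T" unfolding P(2) f_def T_def mem_Times_iff
      by (simp only: fst_conv snd_conv atLeastAtMost_iff) linarith
  qed
  moreover have "card {P \<in> S. f P = k} \<le> 4" if "k \<in> T" for k
  proof (rule hyperbolas_intersection_card[of "fst k" A B "snd k" C D])
    show "\<bar>real_of_int (fst k)\<bar> < dist A B" "\<bar>real_of_int (snd k)\<bar> < dist C D"
      using that a c by (auto simp: T_def)
    show "semi_general_position {P \<in> S. f P = k}"
      using semi_general_position_subset[OF pos] by (auto simp: S_def)
    show "dist P A - dist P B = real_of_int (fst k) \<and> dist P C - dist P D = real_of_int (snd k)"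
      if "P \<in> {P \<in> S. f P = k}" for P
      using that floor[of P A B] floor[of P C D] inM by (auto simp: S_def f_def)
  qed (rule lines)
  ultimately have "card S \<le> 4 * card T"
    using fin by (intro card_le_fibers[where f = f]) (auto simp: S_def T_def)
  moreover have "card T = nat (2 * a - 1) * nat (2 * c - 1)"
    by (simp add: T_def card_cartesian_product algebra_simps)
  ultimately have "int (card S) \<le> 4 * ((2 * a - 1) * (2 * c - 1))"
    using ac by (simp add: nat_mult_distrib flip: of_nat_le_iff[where 'a = int])
  moreover have "card M \<le> card S + 4"
  proof -
    have "card M \<le> card (S \<union> {A, B, C, D})" using fin by (intro card_mono) (auto simp: S_def)
    also have "\<dots> \<le> card S + card {A, B, C, D}" by (rule card_Un_le)
    also have "card {A, B, C, D} \<le> 4" by (auto simp: card_insert_if)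
    finally show ?thesis by simp
  qed
  ultimately have "int (card M) \<le> 4 * ((2 * a - 1) * (2 * c - 1)) + 4" by linarith
  also have "\<dots> \<le> 16 * a * c"
    using ac by (simp add: algebra_simps)
  finally have "real_of_int (int (card M)) \<le> real_of_int (16 * a * c)" by (rule of_int_le_iff[THEN iffD2])
  then show ?thesis by (simp add: a c)
qed

section \<open>Small distances in strips\<close>

lemma wide_edge:
  fixes X Y :: "real ^ 2"
  assumes m: "1 \<le> m" "m \<le> dist X Y" and XY: "X$2 \<le> Y$2" "Y$2 - X$2 \<le> dist X Y - 1/2"
  shows "m - 1/4 \<le> (X$1 - Y$1)\<^sup>2"
proof -
  have "(dist X Y)\<^sup>2 = (X$1 - Y$1)\<^sup>2 + (Y$2 - X$2)\<^sup>2"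
    unfolding dist_norm power2_norm_eq_inner by (simp add: inner_vec_def sum_2 power2_eq_square algebra_simps)
  moreover have "(Y$2 - X$2)\<^sup>2 \<le> (dist X Y - 1/2)\<^sup>2" using XY by (intro power_mono) auto
  moreover have "(dist X Y - 1/2)\<^sup>2 = (dist X Y)\<^sup>2 - dist X Y + 1/4"
    by (simp add: power2_eq_square field_simps)
  ultimately show ?thesis using m by linarith
qed

text \<open>A non-degenerate triangle with integer sides satisfies \<open>a + b \<ge> c + 1\<close>. When
  \<open>B\<close> lies between \<open>A\<close> and \<open>C\<close> in height, \<open>c\<close> is at least the sum of the
  height differences along the other two sides, so that one of these sides exceeds its height
  difference by at least \<open>1/2\<close> and therefore has a horizontal extent of at
  least the order \<open>sqrt m\<close>.\<close>

lemma wide_triangle_sorted: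
  fixes A B C :: "real ^ 2"
  assumes int: "dist A B \<in> \<int>" "dist B C \<in> \<int>" "dist A C \<in> \<int>"
    and nc: "\<not> collinear {A, B, C}" and m: "1 \<le> m" "m \<le> dist A B" "m \<le> dist B C"
    and sorted: "A$2 \<le> B$2" "B$2 \<le> C$2"
  shows "m - 1/4 \<le> (A$1 - B$1)\<^sup>2 \<or> m - 1/4 \<le> (B$1 - C$1)\<^sup>2"
proof -
  have "dist A C < dist A B + dist B C" using triangle_inequality_strict[OF nc] .
  then have "dist A C + 1 \<le> dist A B + dist B C"
    using int by (auto elim!: Ints_cases simp flip: of_int_add)
  moreover have "C$2 - A$2 \<le> dist A C"
    using dist_vec_nth_le[of A 2 C] by (simp add: dist_real_def)
  ultimately have "B$2 - A$2 \<le> dist A B - 1/2 \<or> C$2 - B$2 \<le> dist B C - 1/2" by linarith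
  then show ?thesis using wide_edge[OF m(1,2) sorted(1)] wide_edge[OF m(1,3) sorted(2)] by blast
qed

lemma narrow_strip_card:
  fixes S :: "(real ^ 2) set"
  assumes int: "\<And>P Q. P \<in> S \<Longrightarrow> Q \<in> S \<Longrightarrow> dist P Q \<in> \<int>"
    and pos: "semi_general_position S"
    and m: "1 \<le> m" "\<And>P Q. P \<in> S \<Longrightarrow> Q \<in> S \<Longrightarrow> P \<noteq> Q \<Longrightarrow> m \<le> dist P Q"
    and narrow: "\<And>P Q. P \<in> S \<Longrightarrow> Q \<in> S \<Longrightarrow> (P$1 - Q$1)\<^sup>2 < m - 1/4"
  shows "card S \<le> 2"
proof (rule ccontr)
  assume "\<not> card S \<le> 2"
  then obtain P Q R where PQR: "{P, Q, R} \<subseteq> S" "P \<noteq> Q" "P \<noteq> R" "Q \<noteq> R" by (rule obtain_three)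
  have no: False if "{A, B, C} \<subseteq> S" "A \<noteq> B" "A \<noteq> C" "B \<noteq> C" "A$2 \<le> B$2" "B$2 \<le> C$2" for A B C
  proof -
    have ABC: "A \<in> S" "B \<in> S" "C \<in> S" using that(1) by simp_all
    have "m - 1/4 \<le> (A$1 - B$1)\<^sup>2 \<or> m - 1/4 \<le> (B$1 - C$1)\<^sup>2"
      by (rule wide_triangle_sorted)
         (use ABC int m(1) m(2)[OF ABC(1,2)] m(2)[OF ABC(2,3)] that
            semi_general_positionD[OF pos that(1-4)] in simp_all)
    then show False using narrow[OF ABC(1,2)] narrow[OF ABC(2,3)] by linarith
  qed
  consider "P$2 \<le> Q$2" "Q$2 \<le> R$2" | "P$2 \<le> R$2" "R$2 \<le> Q$2" | "Q$2 \<le> P$2" "P$2 \<le> R$2"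
    | "Q$2 \<le> R$2" "R$2 \<le> P$2" | "R$2 \<le> P$2" "P$2 \<le> Q$2" | "R$2 \<le> Q$2" "Q$2 \<le> P$2"
    by linarith
  then show False
  proof cases
    case 1 then show False using no[of P Q R] PQR by simp
  next
    case 2 then show False using no[of P R Q] PQR by simp
  next
    case 3 then show False using no[of Q P R] PQR by simp
  next
    case 4 then show False using no[of Q R P] PQR by simp
  next
    case 5 then show False using no[of R P Q] PQR by simp
  next
    case 6 then show False using no[of R Q P] PQR by simp
  qed
qed

text \<open>Vertical strips of width \<open>sqrt (m - 1/4)\<close>, closed on the left and open on the right, contain
  at most two points each, and about \<open>d / sqrt (m - 1/4)\<close> of them cover the set. Hence many
  points within a small diameter force a small distance.\<close>

lemma minimum_distance_bound:
  fixes M :: "(real ^ 2) set"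
  assumes fin: "finite M" and int: "\<And>P Q. P \<in> M \<Longrightarrow> Q \<in> M \<Longrightarrow> dist P Q \<in> \<int>"
    and pos: "semi_general_position M"
    and m: "1 \<le> m" "\<And>P Q. P \<in> M \<Longrightarrow> Q \<in> M \<Longrightarrow> P \<noteq> Q \<Longrightarrow> m \<le> dist P Q"
    and d: "0 \<le> d" "\<And>P Q. P \<in> M \<Longrightarrow> Q \<in> M \<Longrightarrow> dist P Q \<le> d"
  shows "(real (card M) - 2) * sqrt (m - 1/4) \<le> 2 * d"
proof (cases "M = {}")
  case True
  then have "(real (card M) - 2) * sqrt (m - 1/4) \<le> 0"
    using m(1) by (intro mult_nonpos_nonneg) auto
  then show ?thesis using d(1) by linarith
next
  case False
  define w where "w = sqrt (m - 1/4)"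
  have w: "w > 0" "w\<^sup>2 = m - 1/4" using m(1) by (simp_all add: w_def)
  obtain O' where O': "O' \<in> M" "\<And>P. P \<in> M \<Longrightarrow> O'$1 \<le> P$1"
    using arg_min_if_finite(1)[OF fin False, of "\<lambda>P. P$1"]
      arg_min_least[OF fin False, of _ "\<lambda>P. P$1"] by blast
  define f where "f P = nat \<lfloor>(P$1 - O'$1) / w\<rfloor>" for P :: "real^2"
  define k where "k = nat \<lfloor>d / w\<rfloor>"
  have "f ` M \<subseteq> {..k}"
  proof
    fix z assume "z \<in> f ` M"
    then obtain P where P: "P \<in> M" "z = f P" by blast
    have "P$1 - O'$1 \<le> d"
      using dist_vec_nth_le[of P 1 O'] d(2)[OF P(1) O'(1)] by (simp add: dist_real_def)
    then show "z \<in> {..k}" unfolding P(2) f_def k_def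
      using w(1) by (auto intro!: nat_mono floor_mono divide_right_mono)
  qed
  moreover have "card {P \<in> M. f P = l} \<le> 2" for l
  proof (rule narrow_strip_card[of _ m])
    show "semi_general_position {P \<in> M. f P = l}"
      using semi_general_position_subset[OF pos] by auto
    fix P Q assume PQ: "P \<in> {P \<in> M. f P = l}" "Q \<in> {P \<in> M. f P = l}"
    have "l \<le> (X$1 - O'$1) / w \<and> (X$1 - O'$1) / w < l + 1" if "X \<in> {P \<in> M. f P = l}" for X
    proof -
      have "0 \<le> (X$1 - O'$1) / w" using that O'(2) w(1) by simp
      moreover have "nat \<lfloor>(X$1 - O'$1) / w\<rfloor> = l" using that by (simp add: f_def)
      ultimately show ?thesis by linarith
    qed
    from this[OF PQ(1)] this[OF PQ(2)]
    have "\<bar>(P$1 - O'$1) / w - (Q$1 - O'$1) / w\<bar> < 1" by linarith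
    also have "(P$1 - O'$1) / w - (Q$1 - O'$1) / w = (P$1 - Q$1) / w" by (simp add: diff_divide_distrib)
    finally have "\<bar>P$1 - Q$1\<bar> < w" using w(1) by (simp add: abs_divide)
    then have "\<bar>P$1 - Q$1\<bar>\<^sup>2 < w\<^sup>2" by (intro power_strict_mono) auto
    then show "(P$1 - Q$1)\<^sup>2 < m - 1/4" using w(2) by simp
  qed (use int m in auto)
  ultimately have "card M \<le> 2 * card {..k}"
    using fin by (intro card_le_fibers[where f = f]) auto
  then have "real (card M) - 2 \<le> 2 * real k" by simp
  also have "real k \<le> d / w" using d(1) w(1) by (simp add: k_def)
  finally have "real (card M) - 2 \<le> 2 * (d / w)" by simp
  then show ?thesis unfolding w_def[symmetric] using w(1) by (simp add: field_simps)
qed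

lemma obtain_closest_pair:
  fixes M :: "'a::metric_space set"
  assumes "finite M" "2 \<le> card M"
  obtains A B where "A \<in> M" "B \<in> M" "A \<noteq> B"
    "\<And>P Q. P \<in> M \<Longrightarrow> Q \<in> M \<Longrightarrow> P \<noteq> Q \<Longrightarrow> dist A B \<le> dist P Q"
proof -
  define E where "E = {(P, Q) \<in> M \<times> M. P \<noteq> Q}"
  obtain T where "T \<subseteq> M" "card T = 2" using obtain_subset_with_card_n[OF assms(2)] by metis
  then have ne: "E \<noteq> {}" by (auto simp: E_def card_2_iff)
  have "finite E" using assms(1) by (auto simp: E_def intro: finite_subset[of _ "M \<times> M"])
  define e where "e = arg_min_on (\<lambda>e. dist (fst e) (snd e)) E"
  have "e \<in> E" unfolding e_def by (rule arg_min_if_finite(1)[OF \<open>finite E\<close> ne])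
  then have "fst e \<in> M" "snd e \<in> M" "fst e \<noteq> snd e" by (auto simp: E_def)
  moreover have "dist (fst e) (snd e) \<le> dist P Q" if "P \<in> M" "Q \<in> M" "P \<noteq> Q" for P Q
    using arg_min_least[OF \<open>finite E\<close> ne, of "(P, Q)" "\<lambda>e. dist (fst e) (snd e)"] that
    by (simp add: E_def e_def)
  ultimately show ?thesis by (rule that)
qed

section \<open>Cardinality and diameter\<close>

text \<open>Let \<open>a\<close> be the smallest distance in \<open>M\<close> and \<open>c\<close> the smallest distance once
  one end of a closest pair has been removed. The strips bound \<open>a\<close> and \<open>c\<close> by a constant
  times \<open>d\<^sup>2 / N\<^sup>2\<close>, while the hyperbolas give \<open>N \<le> 16 * a * c\<close>. The loss from
  replacing \<open>N\<close> by \<open>N - 3\<close> is affordable for \<open>N \<ge> 8\<close>; smaller sets only need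
  \<open>d \<ge> 1\<close> or \<open>d \<ge> 2\<close>.\<close>

lemma card_power_le_diameter_power:
  fixes M :: "(real ^ 2) set"
  assumes fin: "finite M" and int: "\<And>P Q. P \<in> M \<Longrightarrow> Q \<in> M \<Longrightarrow> dist P Q \<in> \<int>"
    and pos: "semi_general_position M" and n: "3 \<le> card M"
    and d: "\<And>P Q. P \<in> M \<Longrightarrow> Q \<in> M \<Longrightarrow> dist P Q \<le> d" "d \<in> \<int>"
  shows "real (card M) ^ 5 \<le> 3125 * d ^ 4"
proof -
  define N where "N = real (card M)"
  have dist1: "1 \<le> dist P Q" if "P \<in> M" "Q \<in> M" "P \<noteq> Q" for P Q
  proof -
    have "dist P Q \<noteq> 0" using that by simp
    then show ?thesis using Ints_nonzero_abs_ge1[OF int[OF that(1,2)]] by simp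
  qed
  obtain A B where AB: "A \<in> M" "B \<in> M" "A \<noteq> B"
    "\<And>P Q. P \<in> M \<Longrightarrow> Q \<in> M \<Longrightarrow> P \<noteq> Q \<Longrightarrow> dist A B \<le> dist P Q"
    using obtain_closest_pair[of M] fin n by auto
  define M' where "M' = M - {A}"
  \<comment> \<open>Without \<open>A\<close>, the closest pair of the rest spans a different line than \<open>A\<close> and
    \<open>B\<close>.\<close>
  have card': "real (card M') = N - 1" using fin AB(1) n by (simp add: M'_def N_def card_Diff_singleton)
  have "finite M'" "2 \<le> card M'" using fin n AB(1) by (auto simp: M'_def card_Diff_singleton)
  then obtain C D where CD: "C \<in> M'" "D \<in> M'" "C \<noteq> D"
    "\<And>P Q. P \<in> M' \<Longrightarrow> Q \<in> M' \<Longrightarrow> P \<noteq> Q \<Longrightarrow> dist C D \<le> dist P Q"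
    using obtain_closest_pair[of M'] by metis
  have d1: "1 \<le> d" using dist1[OF AB(1-3)] d(1)[OF AB(1,2)] by simp
  define a where "a = dist A B"
  define c where "c = dist C D"
  have a1: "1 \<le> a" using dist1[OF AB(1-3)] by (simp add: a_def)
  have c1: "1 \<le> c" using dist1[of C D] CD by (simp add: c_def M'_def)
  consider "N \<le> 5" | "5 < N" "N < 8" | "8 \<le> N" by linarith
  then have "N ^ 5 \<le> 3125 * d ^ 4"
  proof cases
    case 1
    have "N ^ 5 \<le> 5 ^ 5" using 1 by (intro power_mono) (auto simp: N_def)
    also have "\<dots> \<le> 3125 * d ^ 4" using one_le_power[OF d1, of 4] by simp
    finally show ?thesis .
  next
    case 2
    \<comment> \<open>For \<open>d = 1\<close> two strips cover the set, which leaves room for four points only.\<close>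
    have "d \<noteq> 1"
    proof
      assume "d = 1"
      moreover have "(N - 2) * sqrt (1 - 1/4) \<le> 2 * d"
        unfolding N_def by (rule minimum_distance_bound[OF fin int pos _ dist1]) (use d d1 in auto)
      moreover have "sqrt (1 - 1/4) \<ge> (4/5 :: real)" by (rule real_le_rsqrt) (simp add: power2_eq_square)
      moreover have "N \<ge> 6" using 2(1) unfolding N_def by simp
      ultimately have "(4::real) * (4/5) \<le> 2"
        using mult_mono[of 4 "N - 2" "4/5" "sqrt (1 - 1/4)"] by simp
      then show False by simp
    qed
    then have "2 \<le> d" using d1 d(2) by (auto elim!: Ints_cases)
    then have "2 ^ 4 \<le> d ^ 4" by (intro power_mono) auto
    moreover have "N \<le> 7" using 2(2) unfolding N_def by simp
    then have "N ^ 5 \<le> 7 ^ 5" by (intro power_mono) (auto simp: N_def)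
    ultimately show ?thesis by simp
  next
    case 3
    have short: "(N - 3)\<^sup>2 * (3 * x) \<le> 16 * d\<^sup>2"
      if "1 \<le> x" "(N - 3) * sqrt (x - 1/4) \<le> 2 * d" for x
    proof -
      have "((N - 3) * sqrt (x - 1/4))\<^sup>2 \<le> (2 * d)\<^sup>2"
        using that 3 by (intro power_mono mult_nonneg_nonneg) auto
      then have "(N - 3)\<^sup>2 * (4 * x - 1) \<le> 16 * d\<^sup>2"
        using that(1) by (simp add: power_mult_distrib) (simp add: right_diff_distrib)
      moreover have "(N - 3)\<^sup>2 * (3 * x) \<le> (N - 3)\<^sup>2 * (4 * x - 1)"
        using that(1) by (intro mult_left_mono) auto
      ultimately show ?thesis by linarith
    qed
    have "(N - 2) * sqrt (a - 1/4) \<le> 2 * d"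
      unfolding N_def by (rule minimum_distance_bound[OF fin int pos a1]) (use d d1 AB(4) a_def in auto)
    moreover have "(N - 3) * sqrt (a - 1/4) \<le> (N - 2) * sqrt (a - 1/4)"
      using a1 by (intro mult_right_mono) auto
    ultimately have "(N - 3) * sqrt (a - 1/4) \<le> 2 * d" by linarith
    from short[OF a1 this] have a: "(N - 3)\<^sup>2 * (3 * a) \<le> 16 * d\<^sup>2" .
    have "(real (card M') - 2) * sqrt (c - 1/4) \<le> 2 * d"
      by (rule minimum_distance_bound[OF \<open>finite M'\<close> _ semi_general_position_subset[OF pos] c1])
         (use d d1 CD(4) int in \<open>auto simp: c_def M'_def\<close>)
    then have c: "(N - 3)\<^sup>2 * (3 * c) \<le> 16 * d\<^sup>2" using c1 card' by (intro short) auto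
    have "N \<le> 16 * a * c"
      unfolding N_def a_def c_def
      by (rule hyperbola_classes_card[OF fin int pos]) (use AB CD in \<open>auto simp: M'_def\<close>)
    then have "9 * (N - 3) ^ 4 * N \<le> 9 * (N - 3) ^ 4 * (16 * a * c)"
      by (intro mult_left_mono) auto
    also have "\<dots> = 16 * (((N - 3)\<^sup>2 * (3 * a)) * ((N - 3)\<^sup>2 * (3 * c)))"
      by (simp add: power2_eq_square power4_eq_xxxx)
    also have "\<dots> \<le> 16 * ((16 * d\<^sup>2) * (16 * d\<^sup>2))"
      by (rule mult_left_mono[OF mult_mono[OF a c]]) (use c1 in auto)
    also have "\<dots> = 4096 * d ^ 4" by (simp add: power2_eq_square power4_eq_xxxx)
    finally have main: "9 * (N - 3) ^ 4 * N \<le> 4096 * d ^ 4" .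
    \<comment> \<open>The condition \<open>N \<ge> 8\<close> is equivalent to \<open>5 * N \<le> 8 * (N - 3)\<close>.\<close>
    have "(5 * N) ^ 4 \<le> (8 * (N - 3)) ^ 4" using 3 by (intro power_mono) auto
    then have "625 * N ^ 4 \<le> 4096 * (N - 3) ^ 4"
      unfolding power_mult_distrib[of _ _ 4] by simp
    then have "9 * N * (625 * N ^ 4) \<le> 9 * N * (4096 * (N - 3) ^ 4)"
      using 3 by (intro mult_left_mono) auto
    also have "\<dots> = 4096 * (9 * (N - 3) ^ 4 * N)" by simp
    also have "\<dots> \<le> 4096 * (4096 * d ^ 4)" by (rule mult_left_mono[OF main]) simp
    finally have "5625 * N ^ 5 \<le> 16777216 * d ^ 4"
      by (simp add: eval_nat_numeral mult_ac)
    moreover have "0 \<le> d ^ 4" by simp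
    ultimately show ?thesis by linarith
  qed
  then show ?thesis by (simp add: N_def)
qed

section \<open>Existence of point sets and of the minimum\<close>

text \<open>Balls are strictly convex: the middle one of three points of a line would be closer to the
  origin than one of the outer two.\<close>

lemma equal_norm_not_collinear:
  fixes A B C :: "'a::euclidean_space"
  assumes norm: "norm A = r" "norm B = r" "norm C = r" and ne: "A \<noteq> B" "A \<noteq> C" "B \<noteq> C"
  shows "\<not> collinear {A, B, C}"
proof
  have no: False
    if "between (X, Y) Z" "norm X = r" "norm Y = r" "norm Z = r" "Z \<noteq> X" "Z \<noteq> Y" for X Y Z :: 'a
  proof -
    have "Z \<in> open_segment X Y"
      using that by (simp add: between_mem_segment open_segment_def)
    then have "dist 0 Z < dist 0 X \<or> dist 0 Z < dist 0 Y"
      using dist_decreases_open_segment[of Z X Y 0] by simp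
    then show False using that by simp
  qed
  assume "collinear {A, B, C}"
  then have "between (B, C) A \<or> between (C, A) B \<or> between (A, B) C"
    by (simp add: collinear_between_cases)
  then show False using no[of B C A] no[of C A B] no[of A B C] assms by auto
qed

text \<open>The square of the point \<open>c + s * i\<close> of the complex unit circle that has the
  half-angle parameter \<open>t\<close>. Squaring makes all chords between rational parameters rational:
  the chord between the squares
  of two unit numbers \<open>w\<close> and \<open>w'\<close> is twice the absolute value of the sine of the angle
  between \<open>w\<close> and \<open>w'\<close>, a polynomial in their coordinates.\<close>

definition circle_point :: "real \<Rightarrow> real ^ 2" where
  "circle_point t = (let c = (1 - t\<^sup>2) / (1 + t\<^sup>2); s = 2 * t / (1 + t\<^sup>2)
     in vector [c\<^sup>2 - s\<^sup>2, 2 * c * s])"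

lemma half_angle_unit: "((1 - t\<^sup>2) / (1 + t\<^sup>2))\<^sup>2 + (2 * t / (1 + t\<^sup>2))\<^sup>2 = (1::real)"
proof -
  have "1 + t\<^sup>2 \<noteq> 0" by (metis add_pos_nonneg less_irrefl zero_le_power2 zero_less_one)
  then show ?thesis
    by (simp add: power_divide flip: add_divide_distrib) (simp add: power2_eq_square algebra_simps)
qed

lemma norm_circle_point: "norm (circle_point t) = 1"
proof -
  define c s where "c = (1 - t\<^sup>2) / (1 + t\<^sup>2)" and "s = 2 * t / (1 + t\<^sup>2)"
  have "c\<^sup>2 + s\<^sup>2 = 1" unfolding c_def s_def by (rule half_angle_unit)
  then have "(c\<^sup>2 - s\<^sup>2)\<^sup>2 + (2 * c * s)\<^sup>2 = 1" by algebra
  moreover have "circle_point t = vector [c\<^sup>2 - s\<^sup>2, 2 * c * s]"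
    unfolding circle_point_def c_def s_def Let_def ..
  ultimately show ?thesis by (simp add: norm_eq_1 inner_vec_def sum_2 power2_eq_square)
qed

lemma dist_circle_point:
  "dist (circle_point t) (circle_point u)
     = \<bar>4 * ((t - u) * (1 + t * u)) / ((1 + t\<^sup>2) * (1 + u\<^sup>2))\<bar>"
proof -
  define c s where "c = (1 - t\<^sup>2) / (1 + t\<^sup>2)" and "s = 2 * t / (1 + t\<^sup>2)"
  define c' s' where "c' = (1 - u\<^sup>2) / (1 + u\<^sup>2)" and "s' = 2 * u / (1 + u\<^sup>2)"
  have cs: "c\<^sup>2 + s\<^sup>2 = 1" "c'\<^sup>2 + s'\<^sup>2 = 1"
    unfolding c_def s_def c'_def s'_def by (rule half_angle_unit)+
  have p: "circle_point t = vector [c\<^sup>2 - s\<^sup>2, 2 * c * s]"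
    "circle_point u = vector [c'\<^sup>2 - s'\<^sup>2, 2 * c' * s']"
    unfolding circle_point_def c_def s_def c'_def s'_def Let_def by (rule refl)+
  have "(dist (circle_point t) (circle_point u))\<^sup>2
      = (c\<^sup>2 - s\<^sup>2 - (c'\<^sup>2 - s'\<^sup>2))\<^sup>2 + (2 * c * s - 2 * c' * s')\<^sup>2"
    unfolding dist_norm power2_norm_eq_inner p by (simp add: inner_vec_def sum_2 power2_eq_square)
  also have "\<dots> = (2 * (s * c' - c * s'))\<^sup>2" using cs by algebra
  finally have "dist (circle_point t) (circle_point u) = 2 * (s * c' - c * s')
      \<or> dist (circle_point t) (circle_point u) = - (2 * (s * c' - c * s'))"
    by (simp only: power2_eq_iff)
  then have "dist (circle_point t) (circle_point u) = \<bar>2 * (s * c' - c * s')\<bar>"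
    using zero_le_dist[of "circle_point t" "circle_point u"] by linarith
  moreover have "1 + t\<^sup>2 \<noteq> 0" "1 + u\<^sup>2 \<noteq> 0"
    by (metis add_pos_nonneg less_irrefl zero_le_power2 zero_less_one)+
  then have "2 * (s * c' - c * s') = 4 * ((t - u) * (1 + t * u)) / ((1 + t\<^sup>2) * (1 + u\<^sup>2))"
    unfolding c_def s_def c'_def s'_def
    by (simp add: diff_frac_eq frac_eq_eq) (simp add: power2_eq_square algebra_simps)
  ultimately show ?thesis by simp
qed

text \<open>A circle contains arbitrarily many points at rational distances; clearing denominators makes
  the distances integers. The denominator of a distance is
  \<open>(1 + k\<^sup>2) * (1 + l\<^sup>2)\<close>, and each of the two factors divides \<open>D\<close>; hence the scale
  \<open>D\<^sup>2\<close>.\<close>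

lemma semi_general_integral_point_set_exists:
  assumes "3 \<le> n"
  shows "semi_general_integral_point_sets n \<noteq> {}"
proof -
  define D where "D = (\<Prod>k<n. 1 + k\<^sup>2)"
  define p where "p k = real (D\<^sup>2) *\<^sub>R circle_point (real k)" for k
  define M where "M = p ` {..<n}"
  have D: "D > 0" by (auto simp: D_def intro!: prod_pos)
  have dist: "dist (p k) (p l)
      = real (D\<^sup>2) * \<bar>4 * ((real k - real l) * (1 + real k * real l)) / ((1 + (real k)\<^sup>2) * (1 + (real l)\<^sup>2))\<bar>"
    for k l
    by (simp only: p_def dist_norm flip: scaleR_diff_right)
       (simp only: norm_scaleR abs_of_nat dist_circle_point flip: dist_norm)
  have int: "dist (p k) (p l) \<in> \<int>" if "k < n" "l < n" for k l
  proof -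
    have "1 + k\<^sup>2 dvd D" "1 + l\<^sup>2 dvd D" unfolding D_def using that by (auto intro!: dvd_prodI)
    then have "(1 + k\<^sup>2) * (1 + l\<^sup>2) dvd D\<^sup>2" unfolding power2_eq_square[of D] by (rule mult_dvd_mono)
    then obtain e where De: "D\<^sup>2 = (1 + k\<^sup>2) * (1 + l\<^sup>2) * e" by (rule dvdE)
    have e: "real (D\<^sup>2) = (1 + (real k)\<^sup>2) * (1 + (real l)\<^sup>2) * real e"
      unfolding De by (simp only: of_nat_mult of_nat_add of_nat_power of_nat_1)
    have cancel: "W * r * (x / W) = r * x" if "W \<noteq> 0" for W r x :: real
      using that by simp
    have pos: "(1 + (real k)\<^sup>2) * (1 + (real l)\<^sup>2) > 0" by (intro mult_pos_pos add_pos_nonneg) auto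
    have "dist (p k) (p l) = real e * \<bar>4 * ((real k - real l) * (1 + real k * real l))\<bar>"
      unfolding dist e abs_divide abs_of_pos[OF pos]
      by (rule cancel) (rule pos[THEN less_imp_neq, symmetric])
    also have "\<dots> = \<bar>of_int (int e * (4 * ((int k - int l) * (1 + int k * int l))))\<bar>"
      by (simp add: abs_mult)
    also have "\<dots> \<in> \<int>" by simp
    finally show ?thesis .
  qed
  have inj: "inj_on p {..<n}"
  proof (rule inj_onI, rule ccontr)
    fix k l assume kl: "p k = p l" "k \<noteq> l"
    have "1 + real k * real l > 0" "1 + (real k)\<^sup>2 > 0" "1 + (real l)\<^sup>2 > 0"
      by (intro add_pos_nonneg; simp)+
    moreover have "dist (p k) (p l) = 0" using kl by simp
    ultimately show False using kl(2) D unfolding dist by auto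
  qed
  have "norm P = real (D\<^sup>2)" if "P \<in> M" for P
    using that by (auto simp: M_def p_def norm_circle_point)
  then have sgp: "semi_general_position M"
    unfolding semi_general_position_def using equal_norm_not_collinear by metis
  have "p 0 \<in> M" "p 1 \<in> M" "p 2 \<in> M" using assms by (auto simp: M_def)
  moreover have "p 0 \<noteq> p 1" "p 0 \<noteq> p 2" "p 1 \<noteq> p 2"
    using assms inj_on_eq_iff[OF inj] by simp_all
  ultimately have "\<not> collinear {p 0, p 1, p 2}" "{p 0, p 1, p 2} \<subseteq> M"
    using sgp unfolding semi_general_position_def by blast+
  then have "\<not> collinear M" using collinear_subset by blast
  moreover have "card M = n" "finite M" using card_image[OF inj] by (simp_all add: M_def)
  moreover have "\<forall>A\<in>M. \<forall>B\<in>M. dist A B \<in> \<int>" using int by (auto simp: M_def)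
  ultimately have "M \<in> semi_general_integral_point_sets n"
    using sgp by (simp add: semi_general_integral_point_sets_def integral_point_sets_def planar_integral_point_set_def)
  then show ?thesis by blast
qed

lemma integral_point_set_diameter_attained:
  assumes "M \<in> integral_point_sets n" "0 < n"
  obtains A B where "A \<in> M" "B \<in> M" "diameter M = dist A B"
proof -
  have "compact M" "M \<noteq> {}"
    using assms by (auto simp: integral_point_sets_def intro: finite_imp_compact)
  then show ?thesis using diameter_compact_attained that by metis
qed

text \<open>The diameters are natural numbers, so a least one exists among them. Without an element of this
  kind the value of \<open>LEAST\<close> would be unspecified.\<close>

lemma min_semi_general_diameter_attained:
  assumes "3 \<le> n"
  obtains M where "M \<in> semi_general_integral_point_sets n" "min_semi_general_diameter n = diameter M"
proof -
  define S where "S = diameter ` semi_general_integral_point_sets n"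
  have nat: "x \<in> \<nat>" if x: "x \<in> S" for x
  proof -
    obtain M where M: "M \<in> semi_general_integral_point_sets n" "x = diameter M"
      using x by (auto simp: S_def)
    then have "M \<in> integral_point_sets n" by (simp add: semi_general_integral_point_sets_def)
    moreover from this obtain A B where "A \<in> M" "B \<in> M" "x = dist A B"
      using integral_point_set_diameter_attained assms M(2) by (metis less_le_trans zero_less_numeral)
    ultimately show ?thesis
      by (simp add: integral_point_sets_def planar_integral_point_set_def Nats_altdef2)
  qed
  obtain x where "x \<in> S" using semi_general_integral_point_set_exists[OF assms] by (auto simp: S_def)
  with nat have ex: "\<exists>k. real k \<in> S" by (metis Nats_cases)
  define k where "k = (LEAST k. real k \<in> S)"
  have k: "real k \<in> S" unfolding k_def using ex by (rule LeastI_ex)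
  have "(LEAST d. d \<in> S) = real k"
  proof (rule Least_equality)
    show "real k \<in> S" by (rule k)
    fix y assume "y \<in> S"
    then obtain l where "y = real l" "real l \<in> S" using nat Nats_cases by metis
    then show "real k \<le> y" unfolding k_def by (simp add: Least_le)
  qed
  then have "min_semi_general_diameter n \<in> diameter ` semi_general_integral_point_sets n"
    using k by (simp add: min_semi_general_diameter_def S_def)
  then show ?thesis using that by blast
qed

section \<open>The lower bound on the minimal diameter\<close>

theorem theorem3p1:
  fixes n :: nat
  assumes "n \<ge> 3"
  shows "min_semi_general_diameter n \<ge> (real n / 5) powr (5 / 4)"
proof -
  obtain M where M: "M \<in> semi_general_integral_point_sets n" "min_semi_general_diameter n = diameter M"
    using min_semi_general_diameter_attained[OF assms] .
  define d where "d = diameter M"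
  have Mint: "M \<in> integral_point_sets n" and pos: "semi_general_position M"
    using M(1) by (simp_all add: semi_general_integral_point_sets_def)
  then have fin: "finite M" and card: "card M = n" and int: "\<And>P Q. P \<in> M \<Longrightarrow> Q \<in> M \<Longrightarrow> dist P Q \<in> \<int>"
    by (simp_all add: integral_point_sets_def planar_integral_point_set_def)
  obtain A B where AB: "A \<in> M" "B \<in> M" "d = dist A B"
    using integral_point_set_diameter_attained[OF Mint] assms by (auto simp: d_def)
  have d0: "0 \<le> d" and dint: "d \<in> \<int>" using AB int by simp_all
  have le: "dist P Q \<le> d" if "P \<in> M" "Q \<in> M" for P Q
    unfolding d_def using diameter_bounded_bound[OF finite_imp_bounded[OF fin] that] .
  have pw: "(x ^ k) powr (1/4) = x powr (real k / 4)" if "0 < x" for x :: real and k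
    by (simp add: powr_powr powr_realpow[OF that, symmetric])
  have "real n ^ 5 \<le> 3125 * d ^ 4"
    using card_power_le_diameter_power[OF fin int pos _ le dint] card assms by simp
  then have "(real n / 5) ^ 5 \<le> d ^ 4" by (simp add: power_divide)
  then have "((real n / 5) ^ 5) powr (1/4) \<le> (d ^ 4) powr (1/4)" by (intro powr_mono2) auto
  also have "((real n / 5) ^ 5) powr (1/4) = (real n / 5) powr (5/4)"
    using pw[of "real n / 5" 5] assms by simp
  also have "(d ^ 4) powr (1/4) = d"
    using pw[of d 4] d0 by (cases "d = 0") simp_all
  finally show ?thesis using M(2) by (simp add: d_def)
qed

end
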